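(* Let $c=2\left(\frac{\sqrt{2}-1}{2\sqrt{2}}\right)^{\frac{5}{2}}$. For every $\varepsilon>0$ and all sufficiently large $n$ (depending on $\varepsilon$), $$\frac{1}{2}\binom{n}{2}+(1-\varepsilon)\,c\,n^{\frac{3}{2}}\le \mathrm{lbal}(n,K_5)\le \frac{1}{2}\binom{n}{2}+(1+\varepsilon)\frac{1}{4\sqrt{2}}\,n^{\frac{3}{2}}.$$
   Context: A 2-list coloring of the edges of $K_n$ is a function $L:E(K_n)\to\{\{r\},\{b\},\{r,b\}\}$; it induces color classes $R=\{e: r\in L(e)\}$ and $B=\{e: b\in L(e)\}$ (which may intersect). Given a 2-list coloring with color classes $R,B$, a balanced copy of a graph $G=G(V,E)$ is a (not necessarily induced) copy of $G$ in $K_n$ whose edge set has a partition $E_1\sqcup E_2$ with $E_1\subseteq R$, $E_2\subseteq B$ and $\bigl||E_1|-|E_2|\bigr|\le 1$. For $n\ge |V|$, the list balancing number $\mathrm{lbal}(n,G)$ is the smallest integer $k$ such that every 2-list coloring of the edges of $K_n$ with color classes satisfying $|R|,|B|>k$ contains a balanced copy of $G$. *)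

theory Defs
  imports Complex_Main
begin

text \<open>Finite simple graphs are pairs of a vertex set and a set of two-element edges.\<close>

type_synonym 'a graph = "'a set \<times> 'a set set"

definition complete_graph :: "nat \<Rightarrow> nat graph" where
  "complete_graph n = ({..<n}, {e. e \<subseteq> {..<n} \<and> card e = 2})"

datatype colour = Red | Blue

text \<open>A colouring is a total function on sets; only its values on the edges of the complete graph matter.\<close>

definition two_list_colouring :: "nat \<Rightarrow> (nat set \<Rightarrow> colour set) \<Rightarrow> bool" where
  "two_list_colouring n L \<longleftrightarrow>
     (\<forall>e \<in> snd (complete_graph n). L e \<in> {{Red}, {Blue}, {Red, Blue}})"

definition colour_class :: "nat \<Rightarrow> (nat set \<Rightarrow> colour set) \<Rightarrow> colour \<Rightarrow> nat set set" where
  "colour_class n L x = {e \<in> snd (complete_graph n). x \<in> L e}"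

definition graph_iso :: "'a graph \<Rightarrow> 'b graph \<Rightarrow> bool" where
  "graph_iso G H \<longleftrightarrow> (\<exists>f. bij_betw f (fst G) (fst H) \<and> snd H = (\<lambda>e. f ` e) ` snd G)"

definition is_copy :: "nat \<Rightarrow> 'a graph \<Rightarrow> nat graph \<Rightarrow> bool" where
  "is_copy n G H \<longleftrightarrow>
     fst H \<subseteq> fst (complete_graph n) \<and> snd H \<subseteq> snd (complete_graph n) \<and> graph_iso G H"

text \<open>The parts of the partition of the edge set may be empty.\<close>

definition balanced :: "'a set set \<Rightarrow> 'a set set \<Rightarrow> 'a graph \<Rightarrow> bool" where
  "balanced R B H \<longleftrightarrow>
     (\<exists>E1 E2. E1 \<union> E2 = snd H \<and> E1 \<inter> E2 = {} \<and> E1 \<subseteq> R \<and> E2 \<subseteq> B \<and>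
        \<bar>int (card E1) - int (card E2)\<bar> \<le> 1)"

definition forces_balanced_copy :: "nat \<Rightarrow> 'a graph \<Rightarrow> nat \<Rightarrow> bool" where
  "forces_balanced_copy n G k \<longleftrightarrow>
     (\<forall>L. two_list_colouring n L \<and>
          card (colour_class n L Red) > k \<and> card (colour_class n L Blue) > k \<longrightarrow>
          (\<exists>H. is_copy n G H \<and> balanced (colour_class n L Red) (colour_class n L Blue) H))"

text \<open>The threshold ranges over the naturals, so that the minimum exists even for graphs
  with at most one edge, where every negative integer would qualify too. The notion is
  intended for \<open>n \<ge> card (fst G)\<close>.\<close>

definition lbal :: "nat \<Rightarrow> 'a graph \<Rightarrow> nat" where
  "lbal n G = (LEAST k. forces_balanced_copy n G k)"

text \<open>The minimum is attained: the colour classes cannot exceed the edge set in size.\<close>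

lemma forces_balanced_copy_lbal: "forces_balanced_copy n G (lbal n G)"
proof -
  have fin: "finite (snd (complete_graph n))"
    unfolding complete_graph_def by (auto intro: finite_subset[of _ "Pow {..<n}"])
  have "card (colour_class n L x) \<le> card (snd (complete_graph n))" for L x
    using fin by (intro card_mono) (auto simp: colour_class_def)
  then have "forces_balanced_copy n G (card (snd (complete_graph n)))"
    unfolding forces_balanced_copy_def by (meson not_less)
  then show ?thesis
    unfolding lbal_def by (rule LeastI)
qed

end

theory Submission
  imports Defs "HOL-Algebra.Algebraic_Closure_Type"
begin

text \<open>
  A copy of \<open>K\<^sub>5\<close> is balanced iff at most five of its edges are exclusively red and at most five
  are exclusively blue.

  Upper bound: without a balanced copy, any five vertices span at most four edges carrying both
  colours. In such a graph, the paths of length two that start at the two ends of an edge have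
  almost distinct endpoints, so there are at most about \<open>n * e\<close> walks of length three, where \<open>e\<close>
  is the number of edges; the AM-GM inequality bounds this number from below by \<open>(2 * e)^3 / n^2\<close>,
  whence \<open>e\<close> is at most about \<open>(n / 2) powr (3 / 2)\<close>.

  Lower bound: take an exclusively blue clique on about \<open>n / sqrt 2\<close> vertices, give the edges of a
  bipartite graph without 4-cycles on the other vertices both colours, and make everything else
  exclusively red. Every five vertices then span at least six exclusively blue or at least six
  exclusively red edges. The bipartite graph is a part of the point-line incidence
  graph of an affine plane over a field with \<open>2^k\<close> elements. Powers of two are dense enough here:
  the constant \<open>c\<close> is smaller by a factor \<open>2 - sqrt 2\<close> than what an optimal bipartite graph
  would give, and this absorbs the distance to the nearest power of two.
\<close>


section \<open>Balanced copies of K5\<close>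

definition pairs :: "'a set \<Rightarrow> 'a set set" where
  "pairs W = {e. e \<subseteq> W \<and> card e = 2}"

lemma finite_pairs: "finite W \<Longrightarrow> finite (pairs W)"
  unfolding pairs_def by (rule finite_subset[of _ "Pow W"]) auto

lemma card_pairs: "finite W \<Longrightarrow> card (pairs W) = card W choose 2"
  unfolding pairs_def by (rule n_subsets)

lemma pairs_mono: "W \<subseteq> V \<Longrightarrow> pairs W \<subseteq> pairs V"
  by (auto simp: pairs_def)

lemma edges_complete_graph: "snd (complete_graph n) = pairs {..<n}"
  by (simp add: complete_graph_def pairs_def)

lemma image_pairs:
  assumes "inj_on f A"
  shows "(\<lambda>e. f ` e) ` pairs A = pairs (f ` A)"
proof (intro equalityI subsetI)
  fix x assume "x \<in> (\<lambda>e. f ` e) ` pairs A"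
  then show "x \<in> pairs (f ` A)"
    using assms by (auto simp: pairs_def card_image inj_on_subset)
next
  fix x assume "x \<in> pairs (f ` A)"
  then have "x \<subseteq> f ` A" "card x = 2"
    by (auto simp: pairs_def)
  then obtain e where "e \<subseteq> A" "x = f ` e"
    by (meson subset_imageE)
  then have "e \<in> pairs A"
    using \<open>card x = 2\<close> assms by (auto simp: pairs_def card_image inj_on_subset)
  then show "x \<in> (\<lambda>e. f ` e) ` pairs A"
    using \<open>x = f ` e\<close> by blast
qed

lemma is_copy_complete_graph:
  "is_copy n (complete_graph m) H \<longleftrightarrow>
     fst H \<subseteq> {..<n} \<and> card (fst H) = m \<and> snd H = pairs (fst H)"
proof
  assume "is_copy n (complete_graph m) H"
  then obtain f where "fst H \<subseteq> {..<n}" "bij_betw f {..<m} (fst H)"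
    "snd H = (\<lambda>e. f ` e) ` pairs {..<m}"
    unfolding is_copy_def graph_iso_def edges_complete_graph by (auto simp: complete_graph_def)
  moreover from this have "f ` {..<m} = fst H" "inj_on f {..<m}"
    by (simp_all add: bij_betw_def)
  ultimately show "fst H \<subseteq> {..<n} \<and> card (fst H) = m \<and> snd H = pairs (fst H)"
    using image_pairs bij_betw_same_card by fastforce
next
  assume H: "fst H \<subseteq> {..<n} \<and> card (fst H) = m \<and> snd H = pairs (fst H)"
  then have "finite (fst H)"
    using finite_subset by blast
  then obtain f where f: "bij_betw f {..<m} (fst H)"
    using H ex_bij_betw_nat_finite atLeast0LessThan by metis
  then have "(\<lambda>e. f ` e) ` pairs {..<m} = pairs (fst H)"
    using image_pairs by (metis bij_betw_def)
  with f H show "is_copy n (complete_graph m) H"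
    unfolding is_copy_def graph_iso_def edges_complete_graph
    by (auto simp: complete_graph_def pairs_mono intro!: exI[of _ f] dest: pairs_mono)
qed

text \<open>Ten is even, so a difference of at most 1 forces parts of five edges each. Edges outside
  \<open>R\<close> must go to the blue part and edges outside \<open>B\<close> to the red one;
  conversely, \<open>E - B\<close> can be enlarged inside \<open>E \<inter> R\<close> to exactly
  five edges.\<close>

lemma balanced_iff_ten_edges:
  assumes "card (snd H) = 10" "snd H \<subseteq> R \<union> B"
  shows "balanced R B H \<longleftrightarrow> card (snd H - R) \<le> 5 \<and> card (snd H - B) \<le> 5"
proof -
  define E where "E = snd H"
  have E: "card E = 10" "E \<subseteq> R \<union> B"
    using assms by (auto simp: E_def)
  then have fin: "finite E"
    using card.infinite by fastforce
  show ?thesis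
    unfolding E_def[symmetric]
  proof
    assume "balanced R B H"
    then obtain E1 E2 where P: "E1 \<union> E2 = E" "E1 \<inter> E2 = {}" "E1 \<subseteq> R" "E2 \<subseteq> B"
      and diff: "\<bar>int (card E1) - int (card E2)\<bar> \<le> 1"
      unfolding balanced_def E_def by blast
    have f12: "finite E1" "finite E2"
      using fin P(1) by auto
    then have "card E1 + card E2 = 10"
      using E P card_Un_disjoint by metis
    then have "card E1 = 5" "card E2 = 5"
      using diff by linarith+
    moreover have "E - R \<subseteq> E2" "E - B \<subseteq> E1"
      using P by auto
    ultimately show "card (E - R) \<le> 5 \<and> card (E - B) \<le> 5"
      using f12 by (metis card_mono)
  next
    assume small: "card (E - R) \<le> 5 \<and> card (E - B) \<le> 5"
    have "card (E - R) + card (E \<inter> R) = 10"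
      using E fin card_Diff_subset_Int by (metis card_Int_Diff add.commute)
    then have "card (E - B) \<le> 5" "5 \<le> card (E \<inter> R)"
      using small by auto
    moreover have "E - B \<subseteq> E \<inter> R"
      using E by auto
    ultimately obtain E1 where E1: "E - B \<subseteq> E1" "E1 \<subseteq> E \<inter> R" "card E1 = 5"
      using exists_subset_between[of "E - B" 5 "E \<inter> R"] fin by auto
    then have "card (E - E1) = 5"
      using E fin by (subst card_Diff_subset) (auto intro: finite_subset)
    then show "balanced R B H"
      unfolding balanced_def E_def[symmetric]
      using E1 by (intro exI[of _ E1] exI[of _ "E - E1"]) auto
  qed
qed

lemma colour_classes_cover:
  assumes "two_list_colouring n L"
  shows "colour_class n L Red \<union> colour_class n L Blue = pairs {..<n}"
  using assms unfolding two_list_colouring_def colour_class_def edges_complete_graph by auto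

lemma balanced_K5_iff:
  assumes "two_list_colouring n L"
  defines "R \<equiv> colour_class n L Red" and "B \<equiv> colour_class n L Blue"
  shows "(\<exists>H. is_copy n (complete_graph 5) H \<and> balanced R B H) \<longleftrightarrow>
    (\<exists>W \<subseteq> {..<n}. card W = 5 \<and> card (pairs W - R) \<le> 5 \<and> card (pairs W - B) \<le> 5)"
proof -
  have *: "balanced R B (W, pairs W) \<longleftrightarrow> card (pairs W - R) \<le> 5 \<and> card (pairs W - B) \<le> 5"
    if "W \<subseteq> {..<n}" "card W = 5" for W
  proof -
    have "finite W"
      using that(1) finite_subset by blast
    then have "card (pairs W) = 10"
      using that(2) by (simp add: card_pairs choose_two)
    moreover have "pairs W \<subseteq> R \<union> B"
      using pairs_mono[OF that(1)] colour_classes_cover[OF assms(1)] unfolding R_def B_def by simp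
    ultimately show ?thesis
      using balanced_iff_ten_edges[of "(W, pairs W)" R B] by simp
  qed
  have "(\<exists>H. is_copy n (complete_graph 5) H \<and> balanced R B H) \<longleftrightarrow>
    (\<exists>W \<subseteq> {..<n}. card W = 5 \<and> balanced R B (W, pairs W))"
    unfolding is_copy_complete_graph by (metis fst_conv snd_conv surjective_pairing)
  then show ?thesis
    using * by blast
qed

section \<open>Graphs with few edges on five vertices\<close>

text \<open>In the application \<open>H\<close> is the set of edges carrying both colours. With at
  least five vertices available, any smaller vertex set can be enlarged to one of size exactly
  five.\<close>

locale sparse_graph =
  fixes V :: "'a set" and H :: "'a set set"
  assumes finV: "finite V" and cardV: "5 \<le> card V" and HV: "H \<subseteq> pairs V"
    and sparse: "\<And>W. \<lbrakk>W \<subseteq> V; card W = 5\<rbrakk> \<Longrightarrow> card (pairs W \<inter> H) \<le> 4"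
begin

definition N :: "'a \<Rightarrow> 'a set" where "N v = {u \<in> V. {u, v} \<in> H}"

abbreviation d :: "'a \<Rightarrow> nat" where "d v \<equiv> card (N v)"

text \<open>The number of walks of length two starting at \<open>u\<close>, backtracking
  included.\<close>

definition S :: "'a \<Rightarrow> nat" where "S u = (\<Sum>w\<in>N u. d w)"

lemma finN [simp]: "finite (N v)"
  using finV by (simp add: N_def)

lemma N_sub: "N v \<subseteq> V"
  by (auto simp: N_def)

lemma edge_iff: "{u, v} \<in> H \<longleftrightarrow> u \<in> N v"
  using HV by (auto simp: N_def pairs_def)

lemma N_sym: "u \<in> N v \<longleftrightarrow> v \<in> N u"
  by (metis edge_iff insert_commute)

lemma N_irrefl: "u \<in> N v \<Longrightarrow> u \<noteq> v"
  using HV by (auto simp: N_def pairs_def)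

text \<open>This refutes every forbidden configuration below. The vertices
  \<open>a, b, c, x, y\<close> may repeat: the union of the edges is enlarged to a set of exactly
  five vertices.\<close>

lemma no_five_edges:
  assumes "distinct [e1, e2, e3, e4, e5]" "{e1, e2, e3, e4, e5} \<subseteq> H"
    "e1 \<union> e2 \<union> e3 \<union> e4 \<union> e5 \<subseteq> {a, b, c, x, y}"
  shows False
proof -
  define Y where "Y = e1 \<union> e2 \<union> e3 \<union> e4 \<union> e5"
  have Y: "Y \<subseteq> V"
  proof -
    have "\<Union>H \<subseteq> V"
      using HV by (auto simp: pairs_def)
    moreover have "Y = \<Union>{e1, e2, e3, e4, e5}"
      by (auto simp: Y_def)
    ultimately show ?thesis
      using Union_mono[OF assms(2)] by (metis order_trans)
  qed
  have "card Y \<le> card {a, b, c, x, y}"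
    using assms(3) unfolding Y_def by (intro card_mono) auto
  also have "\<dots> \<le> 5"
    by (simp add: card_insert_if)
  finally have "card Y \<le> 5" .
  then obtain W where W: "Y \<subseteq> W" "W \<subseteq> V" "card W = 5"
    using exists_subset_between[of Y 5 V] Y cardV finV by blast
  have "e \<in> pairs W \<inter> H" if "e \<in> {e1, e2, e3, e4, e5}" for e
  proof -
    have "e \<subseteq> Y"
      using that unfolding Y_def by auto
    moreover have "e \<in> H"
      using that assms(2) by (rule subsetD[rotated])
    ultimately show ?thesis
      using HV W(1) unfolding pairs_def by auto
  qed
  then have "{e1, e2, e3, e4, e5} \<subseteq> pairs W \<inter> H"
    by (rule subsetI)
  moreover have "finite (pairs W \<inter> H)"
    using W finV finite_subset finite_pairs by blast
  ultimately have "card {e1, e2, e3, e4, e5} \<le> card (pairs W \<inter> H)"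
    by (rule card_mono[rotated])
  then show False
    using sparse[OF W(2,3)] assms(1) by simp
qed



section \<open>Upper bound for the number of walks of length three\<close>

lemma arc_swap:
  fixes f :: "'a \<Rightarrow> 'a \<Rightarrow> 'b :: comm_monoid_add"
  shows "(\<Sum>u\<in>V. \<Sum>v\<in>N u. f u v) = (\<Sum>u\<in>V. \<Sum>v\<in>N u. f v u)"
  unfolding N_def
  using sum.swap_restrict[OF finV finV, of f "\<lambda>u v. {v, u} \<in> H"] by (simp add: insert_commute)

lemma handshake: "(\<Sum>v\<in>V. d v) = 2 * card H"
proof -
  have finH: "finite H"
    using HV finV finite_pairs finite_subset by blast
  have "(\<Sum>v\<in>V. d v) = card (Sigma V N)"
    using finV by simp
  \<comment> \<open>Group the arcs by their underlying edge; every edge has exactly two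
    orientations.\<close>
  also have "Sigma V N = (\<Union>e\<in>H. {(u, v). {u, v} = e})"
  proof (intro equalityI subsetI)
    fix p assume "p \<in> Sigma V N"
    then show "p \<in> (\<Union>e\<in>H. {(u, v). {u, v} = e})"
      using edge_iff N_sym by auto
  next
    fix p assume "p \<in> (\<Union>e\<in>H. {(u, v). {u, v} = e})"
    then show "p \<in> Sigma V N"
      using edge_iff N_sym N_sub by blast
  qed
  also have "card \<dots> = (\<Sum>e\<in>H. card {(u, v). {u, v} = e})"
  proof (rule card_UN_disjoint[OF finH])
    show "\<forall>e\<in>H. finite {(u, v). {u, v} = e}"
    proof
      fix e assume "e \<in> H"
      then have "e \<subseteq> V"
        using HV by (auto simp: pairs_def)
      then have "finite e"
        using finV by (rule finite_subset)
      moreover have "{(u, v). {u, v} = e} \<subseteq> e \<times> e"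
        by auto
      ultimately show "finite {(u, v). {u, v} = e}"
        using finite_subset by blast
    qed
  qed auto
  also have "\<dots> = (\<Sum>e\<in>H. 2)"
  proof (intro sum.cong refl)
    fix e assume "e \<in> H"
    then obtain a b where ab: "e = {a, b}" "a \<noteq> b"
      using HV by (auto simp: pairs_def card_2_iff)
    then have "{(u, v). {u, v} = e} = {(a, b), (b, a)}"
      by (auto simp: doubleton_eq_iff)
    then show "card {(u, v). {u, v} = e} = 2"
      using ab(2) by simp
  qed
  finally show ?thesis by simp
qed

text \<open>Three common neighbours would give a complete bipartite graph with parts of size 2 and
  3, which has six edges on five vertices.\<close>

lemma card_common_neighbours:
  assumes "u \<noteq> w"
  shows "card (N u \<inter> N w) \<le> 2"
proof (rule ccontr)
  assume "\<not> ?thesis"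
  then have "3 \<le> card (N u \<inter> N w)" by simp
  then obtain T where "T \<subseteq> N u \<inter> N w" "card T = 3"
    by (meson obtain_subset_with_card_n)
  then obtain a b c where *: "a \<in> N u \<inter> N w" "b \<in> N u \<inter> N w" "c \<in> N u \<inter> N w"
    "a \<noteq> b" "b \<noteq> c" "a \<noteq> c"
    by (auto simp: card_3_iff)
  then have "a \<noteq> u" "b \<noteq> u" "c \<noteq> u" "a \<noteq> w" "b \<noteq> w"
    using N_irrefl by blast+
  with * assms show False
    by (intro no_five_edges[of "{a, u}" "{b, u}" "{c, u}" "{a, w}" "{b, w}" a b c u w]) (simp_all add: edge_iff doubleton_eq_iff)
qed

text \<open>Sorting the walks by their endpoint \<open>x\<close> turns \<open>S u\<close> into the
  sum of \<open>card (N u \<inter> N x)\<close>. Each \<open>x \<noteq> u\<close> contributes at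
  most 2, and \<open>x = u\<close> contributes the degree of \<open>u\<close>, at most
  \<open>card V\<close>.\<close>

lemma S_le:
  assumes "u \<in> V"
  shows "S u \<le> 3 * card V"
proof -
  have "S u = (\<Sum>w\<in>{w \<in> V. w \<in> N u}. \<Sum>x\<in>{x \<in> V. x \<in> N w}. 1)"
    unfolding S_def using N_sub by (auto intro!: sum.cong arg_cong[where f = card])
  also have "\<dots> = (\<Sum>w\<in>N u. \<Sum>x\<in>{x \<in> V. x \<in> N w}. 1)"
    using N_sub by (intro sum.cong) auto
  also have "\<dots> = (\<Sum>x\<in>V. \<Sum>w\<in>{w \<in> N u. x \<in> N w}. 1)"
    using finV by (intro sum.swap_restrict) auto
  also have "\<dots> = (\<Sum>x\<in>V. card (N u \<inter> N x))"
    using N_sym by (auto intro!: sum.cong arg_cong[where f = card])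
  also have "\<dots> \<le> (\<Sum>x\<in>V. 2 + (if x = u then card V else 0))"
  proof (rule sum_mono)
    fix x assume "x \<in> V"
    show "card (N u \<inter> N x) \<le> 2 + (if x = u then card V else 0)"
      using card_common_neighbours[of u x] card_mono[OF finV N_sub[of u]] by auto
  qed
  also have "\<dots> = 3 * card V"
    unfolding sum.distrib using finV assms by (simp del: sum_constant) simp
  finally show ?thesis .
qed

text \<open>4-cycles may occur as components, so two vertices can have two common neighbours; the
  resulting quadratic bound is still of lower order than the walk count.\<close>

lemma sum_degree_squares: "(\<Sum>u\<in>V. d u * d u) \<le> 3 * (card V)\<^sup>2"
proof -
  have "(\<Sum>u\<in>V. d u * d u) = (\<Sum>u\<in>V. \<Sum>v\<in>N u. d u)"
    by simp
  also have "\<dots> = (\<Sum>u\<in>V. S u)"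
    unfolding S_def by (rule arc_swap)
  also have "\<dots> \<le> (\<Sum>u\<in>V. 3 * card V)"
    by (intro sum_mono S_le)
  finally show ?thesis
    by (simp add: power2_eq_square)
qed

text \<open>For an edge \<open>u v\<close> these are the continuations \<open>(w, x)\<close> of the walk \<open>v, u\<close> without backtracking.\<close>

definition P :: "'a \<Rightarrow> 'a \<Rightarrow> ('a \<times> 'a) set" where
  "P u v = Sigma (N u - {v}) (\<lambda>w. N w - {u})"

lemma finP: "finite (P u v)"
  by (simp add: P_def)

text \<open>The walks from \<open>u\<close> missing from \<open>P u v\<close> either return to
  \<open>u\<close> (one for each neighbour of \<open>u\<close>) or pass through \<open>v\<close>
  (one for each neighbour of \<open>v\<close>).\<close>

lemma S_le_P:
  assumes "v \<in> N u"
  shows "S u \<le> card (P u v) + d u + d v"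
proof -
  have "S u = card (Sigma (N u) N)"
    by (simp add: S_def)
  also have "\<dots> \<le> card (P u v \<union> (\<lambda>w. (w, u)) ` N u \<union> (\<lambda>x. (v, x)) ` N v)"
    by (intro card_mono) (auto simp: finP P_def)
  also have "\<dots> \<le> card (P u v) + card ((\<lambda>w. (w, u)) ` N u) + card ((\<lambda>x. (v, x)) ` N v)"
    by (meson card_Un_le add_mono order_trans order_refl)
  also have "\<dots> \<le> card (P u v) + d u + d v"
    by (intro add_mono card_image_le) auto
  finally show ?thesis .
qed

text \<open>Two walks \<open>u, w, x\<close> and \<open>u, w', x\<close> form a 4-cycle; with the
  edge \<open>{v, u}\<close> these are five edges on at most five vertices. The endpoint
  \<open>x\<close> may be \<open>v\<close> itself.\<close>

lemma inj_on_snd_P: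
  assumes "v \<in> N u"
  shows "inj_on snd (P u v)"
proof (rule inj_onI, rule ccontr)
  fix p p' assume *: "p \<in> P u v" "p' \<in> P u v" "snd p = snd p'" "p \<noteq> p'"
  obtain w x w' where [simp]: "p = (w, x)" "p' = (w', x)"
    using *(3) by (metis prod.collapse)
  have "w \<noteq> w'" "w \<in> N u" "w' \<in> N u" "w \<noteq> v" "w' \<noteq> v" "x \<in> N w" "x \<in> N w'" "x \<noteq> u"
    using * by (auto simp: P_def)
  moreover from this have "w \<noteq> u" "w' \<noteq> u" "x \<noteq> w" "x \<noteq> w'" "v \<noteq> u"
    using N_irrefl assms by blast+
  ultimately show False
    using assms
    by (intro no_five_edges[of "{v, u}" "{w, u}" "{w', u}" "{x, w}" "{x, w'}" u v w w' x]) (simp_all add: edge_iff doubleton_eq_iff)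
qed

text \<open>If the middle vertices \<open>w\<close> and \<open>w'\<close> differed, the two paths to
  \<open>x\<close> would close up with the edge \<open>{v, u}\<close> to a 5-cycle. Hence they
  agree, and \<open>x\<close> hangs from a triangle on \<open>u\<close>, \<open>v\<close>,
  \<open>w\<close>.\<close>

lemma common_endpoint:
  assumes "v \<in> N u" "x \<in> snd ` P u v" "x \<in> snd ` P v u"
  obtains w where "w \<in> N u" "w \<in> N v" "x \<in> N w" "x \<noteq> u" "x \<noteq> v"
proof -
  from assms obtain w w' where *: "(w, x) \<in> P u v" "(w', x) \<in> P v u"
    by auto
  have 1: "w \<in> N u" "w \<noteq> v" "w' \<in> N v" "w' \<noteq> u" "x \<in> N w" "x \<in> N w'" "x \<noteq> u" "x \<noteq> v"
    using * by (auto simp: P_def)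
  moreover from this have "w \<noteq> u" "w' \<noteq> v" "x \<noteq> w" "x \<noteq> w'" "v \<noteq> u"
    using N_irrefl assms(1) by blast+
  ultimately have False if "w \<noteq> w'"
    using that assms(1)
    by (intro no_five_edges[of "{v, u}" "{w, u}" "{w', v}" "{x, w}" "{x, w'}" u v w w' x])
      (simp_all add: edge_iff doubleton_eq_iff)
  then have "w = w'"
    by blast
  then show thesis
    using that 1 by blast
qed

text \<open>By injectivity the walks can be counted by their endpoints, so it suffices that the two
  endpoint sets share at most one vertex. Two shared endpoints \<open>x\<close> and \<open>y\<close>
  would hang either from one triangle on \<open>u v\<close>, giving a triangle with two pendant
  edges, or from two different triangles sharing the edge \<open>u v\<close>. Both configurations
  have five edges on at most five vertices.\<close>

lemma card_P_add:
  assumes "v \<in> N u" "u \<in> V"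
  shows "card (P u v) + card (P v u) \<le> card V + 1"
proof -
  have uv: "u \<in> N v"
    using assms(1) N_sym by blast
  let ?X = "snd ` P u v" and ?Y = "snd ` P v u"
  have "x = y" if xy: "x \<in> ?X \<inter> ?Y" "y \<in> ?X \<inter> ?Y" for x y
  proof (rule ccontr)
    assume "x \<noteq> y"
    obtain w where w: "w \<in> N u" "w \<in> N v" "x \<in> N w" "x \<noteq> u" "x \<noteq> v"
      using xy common_endpoint[OF assms(1)] by blast
    obtain z where z: "z \<in> N u" "z \<in> N v" "y \<in> N z" "y \<noteq> u" "y \<noteq> v"
      using xy common_endpoint[OF assms(1)] by blast
    have ne: "w \<noteq> u" "w \<noteq> v" "x \<noteq> w" "z \<noteq> u" "z \<noteq> v" "y \<noteq> z" "v \<noteq> u"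
      using w z N_irrefl assms(1) by blast+
    show False
    proof (cases "w = z")
      case True
      then show False
        using \<open>x \<noteq> y\<close> w z ne assms(1)
        by (intro no_five_edges[of "{v, u}" "{w, u}" "{w, v}" "{x, w}" "{y, w}" u v w x y]) (simp_all add: edge_iff doubleton_eq_iff)
    next
      case False
      then show False
        using w z ne assms(1)
        by (intro no_five_edges[of "{v, u}" "{w, u}" "{w, v}" "{z, u}" "{z, v}" u v w z z]) (simp_all add: edge_iff doubleton_eq_iff)
    qed
  qed
  then have "\<forall>x\<in>?X \<inter> ?Y. \<forall>y\<in>?X \<inter> ?Y. x = y"
    by blast
  moreover have "finite (?X \<inter> ?Y)"
    by (simp add: finP)
  ultimately have "card (?X \<inter> ?Y) \<le> 1"
    unfolding One_nat_def by (simp only: card_le_Suc0_iff_eq)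
  moreover have "card (?X \<union> ?Y) \<le> card V"
    using finV by (intro card_mono) (auto simp: P_def dest: N_sub[THEN subsetD])
  moreover have "card ?X + card ?Y = card (?X \<union> ?Y) + card (?X \<inter> ?Y)"
    by (intro card_Un_Int) (auto simp: finP)
  ultimately show ?thesis
    using card_image[OF inj_on_snd_P[OF assms(1)]] card_image[OF inj_on_snd_P[OF uv]] by simp
qed

lemma S_add_S:
  assumes "v \<in> N u" "u \<in> V"
  shows "S u + S v \<le> card V + 1 + 2 * d u + 2 * d v"
  using card_P_add[OF assms] S_le_P[OF assms(1)] S_le_P[of u v] assms(1) N_sym[of u v] by simp

text \<open>The sum of \<open>d u * d v\<close> over arcs counts walks of length three by their
  middle arc, and it equals the sum of \<open>S u\<close> over arcs. Doubling it pairs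
  \<open>S u\<close> with \<open>S v\<close>, so that \<open>S_add_S\<close> applies; the leftover
  degree terms add up to four times the sum of squared degrees.\<close>

lemma three_walks_upper:
  "2 * (\<Sum>u\<in>V. \<Sum>v\<in>N u. d u * d v) \<le> (card V + 1) * (\<Sum>v\<in>V. d v) + 12 * (card V)\<^sup>2"
proof -
  have 1: "(\<Sum>u\<in>V. \<Sum>v\<in>N u. S u) = (\<Sum>u\<in>V. \<Sum>v\<in>N u. d u * d v)"
    by (simp add: S_def sum_distrib_left)
  have "2 * (\<Sum>u\<in>V. \<Sum>v\<in>N u. d u * d v) = (\<Sum>u\<in>V. \<Sum>v\<in>N u. S u + S v)"
    unfolding sum.distrib arc_swap[of "\<lambda>u v. S v"] 1 by simp
  also have "\<dots> \<le> (\<Sum>u\<in>V. \<Sum>v\<in>N u. card V + 1 + 2 * d u + 2 * d v)"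
    by (intro sum_mono S_add_S)
  also have "\<dots> = (\<Sum>u\<in>V. \<Sum>v\<in>N u. card V + 1) + (\<Sum>u\<in>V. \<Sum>v\<in>N u. 2 * d u) + (\<Sum>u\<in>V. \<Sum>v\<in>N u. 2 * d v)"
    by (simp only: sum.distrib)
  also have "\<dots> = (card V + 1) * (\<Sum>v\<in>V. d v) + 4 * (\<Sum>u\<in>V. d u * d u)"
    unfolding arc_swap[of "\<lambda>u v. 2 * d v"]    by (simp add: sum_distrib_left sum_distrib_right mult_ac sum.distrib flip: sum_distrib_left)
  finally show ?thesis
    using sum_degree_squares by linarith
qed

end

section \<open>Lower bound for the number of walks of length three\<close>

text \<open>This is AM-GM for the three numbers \<open>x * y\<close>, \<open>t^3 / x\<close> and
  \<open>t^3 / y\<close>, whose product is \<open>t^6\<close>. Equality holds at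
  \<open>x = y = t\<close>.\<close>

lemma amgm3:
  fixes x y t :: real
  assumes "x > 0" "y > 0" "t \<ge> 0"
  shows "3 * t\<^sup>2 - t ^ 3 * (1 / x + 1 / y) \<le> x * y"
proof -
  define p where "p = sqrt (x * y)"
  have p: "p > 0" "p\<^sup>2 = x * y"
    using assms by (auto simp: p_def)
  have xy: "x + y \<ge> 2 * p"
    unfolding p_def using assms arith_geo_mean_sqrt[of x y] by simp
  \<comment> \<open>Since \<open>x + y\<close> is at least \<open>2 * p\<close>, the case
    \<open>x = y = p\<close> suffices; there the difference of the two sides, cleared of
    denominators, has this factorization.\<close>
  have "p * (p - t)\<^sup>2 * (p + 2 * t) \<ge> 0"
    using p assms by simp
  then have "3 * t\<^sup>2 * p\<^sup>2 \<le> p\<^sup>2 * p\<^sup>2 + t ^ 3 * (2 * p)"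
    by (simp add: algebra_simps power2_eq_square power3_eq_cube)
  also have "\<dots> \<le> p\<^sup>2 * p\<^sup>2 + t ^ 3 * (x + y)"
    using xy assms by (intro add_left_mono mult_left_mono) auto
  finally have "3 * t\<^sup>2 * (x * y) \<le> (x * y) * (x * y) + t ^ 3 * (x + y)"
    unfolding p .
  then show ?thesis
    using assms by (simp add: field_simps power2_eq_square)
qed

context sparse_graph begin

text \<open>Apply \<open>amgm3\<close> to the degrees at the ends of every arc, with
  \<open>t\<close> the average degree. The reciprocal degrees sum to at most \<open>n\<close> over
  all arcs, since a vertex with neighbours contributes 1 and an isolated one contributes 0.\<close>

lemma three_walks_lower:
  defines "D \<equiv> real (\<Sum>v\<in>V. d v)" and "n \<equiv> real (card V)"
  shows "D ^ 3 / n\<^sup>2 \<le> real (\<Sum>u\<in>V. \<Sum>v\<in>N u. d u * d v)"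
proof -
  define t where "t = D / n"
  have n: "n > 0"
    using cardV by (simp add: n_def)
  have t: "t \<ge> 0"
    by (simp add: t_def D_def n_def sum_nonneg)
  have inv: "(\<Sum>u\<in>V. \<Sum>v\<in>N u. 1 / real (d u)) \<le> n"
  proof -
    have "(\<Sum>u\<in>V. \<Sum>v\<in>N u. 1 / real (d u)) \<le> (\<Sum>u\<in>V. 1)"
      by (intro sum_mono) auto
    then show ?thesis by (simp add: n_def)
  qed
  have "D ^ 3 / n\<^sup>2 = 3 * t\<^sup>2 * D - 2 * t ^ 3 * n"
    using n by (simp add: t_def field_simps power2_eq_square power3_eq_cube)
  also have "\<dots> \<le> 3 * t\<^sup>2 * D - 2 * t ^ 3 * (\<Sum>u\<in>V. \<Sum>v\<in>N u. 1 / real (d u))"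
    using inv t by (intro diff_left_mono mult_left_mono) auto
  also have "\<dots> = 3 * t\<^sup>2 * D - t ^ 3 * ((\<Sum>u\<in>V. \<Sum>v\<in>N u. 1 / real (d u)) + (\<Sum>u\<in>V. \<Sum>v\<in>N u. 1 / real (d v)))"
    unfolding arc_swap[of "\<lambda>u v. 1 / real (d v)"] by simp
  also have "\<dots> = (\<Sum>u\<in>V. \<Sum>v\<in>N u. 3 * t\<^sup>2 - t ^ 3 * (1 / real (d u) + 1 / real (d v)))"
    unfolding D_def of_nat_sum
    by (simp only: sum_subtractf sum_distrib_left[symmetric] sum.distrib sum_constant)
      (simp add: sum_distrib_left mult_ac)
  also have "\<dots> \<le> (\<Sum>u\<in>V. \<Sum>v\<in>N u. real (d u) * real (d v))"
  proof (intro sum_mono amgm3 t)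
    fix u v assume "u \<in> V" "v \<in> N u"
    then have "N u \<noteq> {}" "N v \<noteq> {}"
      using N_sym by blast+
    then show "real (d u) > 0" "real (d v) > 0"
      by (auto simp: card_gt_0_iff)
  qed
  finally show ?thesis
    by simp
qed

text \<open>Up to lower-order terms this says \<open>2 * D^2 \<le> n^3\<close>, that is,
  \<open>card H\<close> is at most about \<open>(n / 2) powr (3 / 2)\<close>.\<close>

lemma edge_inequality:
  defines "D \<equiv> 2 * real (card H)" and "n \<equiv> real (card V)"
  shows "2 * D ^ 3 \<le> n\<^sup>2 * ((n + 1) * D + 12 * n\<^sup>2)"
proof -
  have n: "n > 0"
    using cardV by (simp add: n_def)
  have D: "real (\<Sum>v\<in>V. d v) = D"
    unfolding handshake by (simp add: D_def)
  have "real (2 * (\<Sum>u\<in>V. \<Sum>v\<in>N u. d u * d v)) \<le> real ((card V + 1) * (\<Sum>v\<in>V. d v) + 12 * (card V)\<^sup>2)"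
    using three_walks_upper by (rule of_nat_mono)
  also have "\<dots> = (n + 1) * D + 12 * n\<^sup>2"
    by (simp only: of_nat_add of_nat_mult D of_nat_power of_nat_numeral n_def of_nat_1)
  finally have "2 * (D ^ 3 / n\<^sup>2) \<le> (n + 1) * D + 12 * n\<^sup>2"
    using three_walks_lower unfolding D n_def[symmetric] by simp
  then show ?thesis
    using n by (simp add: field_simps)
qed

end

section \<open>A rectangle-free incidence structure over a finite field\<close>

text \<open>Seen as a bipartite graph, \<open>I\<close> has no 4-cycle: two points share at most one
  line.\<close>

definition rectangle_free :: "('a \<times> 'b) set \<Rightarrow> bool" where
  "rectangle_free I \<longleftrightarrow> (\<forall>p p' l l'. (p, l) \<in> I \<and> (p', l) \<in> I \<and> (p, l') \<in> I \<and> (p', l') \<in> I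
     \<longrightarrow> p = p' \<or> l = l')"

section \<open>The field with \<open>2^k\<close> elements inside an algebraic closure\<close>

text \<open>Over an algebraically closed field the multiplicities of the roots add up to the degree,
  and a root of multiplicity at least 2 would also be a root of the derivative.\<close>

lemma card_roots_separable:
  fixes p :: "'a :: alg_closed_field poly"
  assumes p0: "p \<noteq> 0" and sep: "\<And>x. poly p x = 0 \<Longrightarrow> poly (pderiv p) x \<noteq> 0"
  shows "card {x. poly p x = 0} = degree p"
proof -
  obtain A where A: "size A = degree p" "p = smult (lead_coeff p) (\<Prod>x\<in>#A. [:-x, 1:])"
    using alg_closed_imp_factorization[OF p0] by blast
  have "proots p = proots (\<Prod>x\<in>#A. [:-x, 1:])"
    using p0 by (subst A(2)) simp
  also have "\<dots> = A"
  proof (induction A)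
    case (add x A)
    have "proots ([:-x, 1:] * (\<Prod>x\<in>#A. [:-x, 1:])) = add_mset x A"
      by (subst proots_mult) (auto simp: add prod_mset_zero_iff simp del: mult_pCons_left)
    then show ?case by simp
  qed simp
  finally have "degree p = size (proots p)"
    using A(1) by simp
  also have "\<dots> = (\<Sum>x\<in>{x. poly p x = 0}. order x p)"
    using p0 by (simp add: size_multiset_overloaded_eq)
  also have "\<dots> = (\<Sum>x\<in>{x. poly p x = 0}. 1)"
  proof (intro sum.cong refl)
    fix x assume "x \<in> {x. poly p x = 0}"
    then have x: "poly p x = 0" by simp
    have "\<not> 2 \<le> order x p"
    proof
      assume "2 \<le> order x p"
      then have "[:-x, 1:]\<^sup>2 dvd p"
        using order_1 power_le_dvd by blast
      then obtain q where "p = [:-x, 1:] * ([:-x, 1:] * q)"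
        by (metis dvdE mult.assoc power2_eq_square)
      then have "poly (pderiv p) x = 0"
        by (simp add: pderiv_mult del: mult_pCons_left)
      then show False
        using sep x by blast
    qed
    moreover have "order x p > 0"
      using x p0 by (simp add: order_gt_0_iff)
    ultimately show "order x p = 1" by simp
  qed
  finally show ?thesis by simp
qed

lemma CHAR_gf2 [simp]: "CHAR(gf2) = 2"
proof -
  have "(1 :: gf2) + 1 = 0"
    by transfer simp
  then have "of_nat 2 = (0 :: gf2)"
    by simp
  then have "CHAR(gf2) dvd 2"
    using of_nat_eq_0_iff_char_dvd by blast
  moreover have "CHAR(gf2) \<noteq> 1"
    using CHAR_not_1[where 'a = gf2] by simp
  ultimately show ?thesis
    by (metis prime_nat_iff two_is_prime_nat)
qed

text \<open>The elements are the roots of \<open>X^(2^k) - X\<close>, whose derivative is the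
  constant -1 because \<open>2^k\<close> vanishes in characteristic 2. They form the field with
  \<open>2^k\<close> elements.\<close>

lemma card_fixed_frobenius:
  fixes k :: nat
  assumes "k > 0"
  shows "card {x :: gf2 alg_closure. x ^ 2 ^ k = x} = 2 ^ k"
proof -
  define p :: "gf2 alg_closure poly" where "p = monom 1 (2 ^ k) - monom 1 1"
  have big: "(2::nat) ^ k > 1"
    using assms by (intro one_less_power) auto
  have two: "of_nat (2 ^ k) = (0 :: gf2 alg_closure)"
    using assms by (subst of_nat_eq_0_iff_char_dvd) simp
  have deg: "degree p = 2 ^ k"
    unfolding p_def diff_conv_add_uminus using big
    by (subst degree_add_eq_left) (auto simp: degree_monom_eq)
  have "pderiv p = -1"
    unfolding p_def pderiv_diff pderiv_monom two by (simp add: monom_0 one_pCons)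
  then have "card {x. poly p x = 0} = 2 ^ k"
    using deg by (subst card_roots_separable) auto
  moreover have "poly p x = 0 \<longleftrightarrow> x ^ 2 ^ k = x" for x
    by (simp add: p_def poly_monom)
  ultimately show ?thesis by simp
qed

text \<open>Points are pairs \<open>(x, y)\<close> and lines are \<open>y = s * x + t\<close>, with
  first coordinates and slopes restricted to \<open>a\<close> field elements. Each triple
  \<open>(x, s, t)\<close> yields one incidence.\<close>

lemma rectangle_free_incidence:
  fixes a k :: nat
  assumes "a \<le> 2 ^ k" "k > 0"
  obtains I where "I \<subseteq> {..<a * 2 ^ k} \<times> {..<a * 2 ^ k}" "card I = a\<^sup>2 * 2 ^ k"
    "rectangle_free I"
proof -
  define F where "F = {x :: gf2 alg_closure. x ^ 2 ^ k = x}"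
  have cF: "card F = 2 ^ k"
    unfolding F_def using card_fixed_frobenius[OF assms(2)] .
  then have finF: "finite F"
    by (intro card_ge_0_finite) simp
  have add: "x + y \<in> F" if "x \<in> F" "y \<in> F" for x y
    \<comment> \<open>Fixed points of the iterated Frobenius map are closed under addition because
      that map is additive.\<close>
    using that freshmans_dream'[of "2 ^ k" k x y] by (simp add: F_def)
  have mult: "x * y \<in> F" if "x \<in> F" "y \<in> F" for x y
    using that by (simp add: F_def power_mult_distrib)
  obtain A where A: "A \<subseteq> F" "card A = a" "finite A"
    using obtain_subset_with_card_n[of a F] assms(1) cF by auto
  have "card (A \<times> F) = a * 2 ^ k" "finite (A \<times> F)"
    using A finF by (auto simp: card_cartesian_product cF)
  then obtain g where g: "bij_betw g (A \<times> F) {..<a * 2 ^ k}"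
    by (metis ex_bij_betw_finite_nat atLeast0LessThan)
  then have gi: "inj_on g (A \<times> F)"
    by (rule bij_betw_imp_inj_on)
  have gim: "g x \<in> {..<a * 2 ^ k}" if "x \<in> A \<times> F" for x
    using g that bij_betwE by blast
  define h where "h = (\<lambda>(x, s, t). (g (x, s * x + t), g (s, t)))"
  define I where "I = h ` (A \<times> A \<times> F)"
  have inF: "s * x + t \<in> F" if "x \<in> A" "s \<in> A" "t \<in> F" for x s t
    using that A add mult by blast
  have "inj_on h (A \<times> A \<times> F)"
    using inF by (auto simp: inj_on_def h_def dest!: inj_onD[OF gi])
  then have cI: "card I = a\<^sup>2 * 2 ^ k"
    by (simp add: I_def card_image card_cartesian_product A cF power2_eq_square)
  have sub: "I \<subseteq> {..<a * 2 ^ k} \<times> {..<a * 2 ^ k}"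
    using inF gim unfolding I_def h_def by fastforce
  have mem: "\<exists>x y s t. x \<in> A \<and> y \<in> F \<and> s \<in> A \<and> t \<in> F \<and> p = g (x, y) \<and> l = g (s, t) \<and> y = s * x + t"
    if "(p, l) \<in> I" for p l
    using that inF unfolding I_def h_def by fastforce
  have mem': "y = s * x + t" if "(g (x, y), g (s, t)) \<in> I" "x \<in> A" "y \<in> F" "s \<in> A" "t \<in> F" for x y s t
    using mem[OF that(1)] that(2-) by (auto dest!: inj_onD[OF gi])
  have "p = p' \<or> l = l'"
    if rect: "(p, l) \<in> I" "(p', l) \<in> I" "(p, l') \<in> I" "(p', l') \<in> I" for p p' l l'
  proof -
    obtain x y s t where 1: "x \<in> A" "y \<in> F" "s \<in> A" "t \<in> F" "p = g (x, y)" "l = g (s, t)"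
      using mem[OF rect(1)] by blast
    obtain x' y' s' t' where 2: "x' \<in> A" "y' \<in> F" "s' \<in> A" "t' \<in> F" "p' = g (x', y')" "l' = g (s', t')"
      using mem[OF rect(4)] by blast
    have e: "y = s * x + t" "y' = s * x' + t" "y = s' * x + t'" "y' = s' * x' + t'"
      using rect 1 2 mem' by auto
    \<comment> \<open>Two lines through two common points agree at \<open>x\<close> and at
      \<open>x'\<close>; without zero divisors either the slopes or the first coordinates coincide,
      and the other coordinates follow.\<close>
    have "(s - s') * (x - x') = (s * x + t) - (s' * x + t') - ((s * x' + t) - (s' * x' + t'))"
      by (simp add: algebra_simps)
    also have "\<dots> = 0"
      using e by simp
    finally have "(s - s') * (x - x') = 0" .
    then have "s = s' \<or> x = x'"
      by auto
    then show ?thesis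
      using 1 2 e by auto
  qed
  then have "rectangle_free I"
    unfolding rectangle_free_def by blast
  then show thesis
    using that sub cI by blast
qed

section \<open>The extremal colouring\<close>

lemma rectangle_free_converse: "rectangle_free I \<Longrightarrow> rectangle_free (I\<inverse>)"
  unfolding rectangle_free_def converse_iff by blast

text \<open>Two rows share at most one column, so they contain at most
  \<open>card T + 1 \<le> 4\<close> incidences; a single row contains at most
  \<open>card T \<le> 4\<close>.\<close>

lemma rectangle_free_two_rows:
  assumes I: "rectangle_free I" and fin: "finite S" "finite T"
    and small: "card S \<le> 2" "card S + card T \<le> 5"
  shows "card (I \<inter> S \<times> T) \<le> 4"
proof -
  consider "card S = 0" | "card S = 1" | "card S = 2"
    using small(1) by linarith
  then show ?thesis
  proof cases
    case 1
    then show ?thesis using fin by simp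
  next
    case 2
    have "card (I \<inter> S \<times> T) \<le> card (S \<times> T)"
      using fin by (intro card_mono) auto
    then show ?thesis
      using 2 small by (simp add: card_cartesian_product)
  next
    case 3
    then obtain x x' where S: "S = {x, x'}" "x \<noteq> x'"
      by (auto simp: card_2_iff)
    define A where "A = {y \<in> T. (x, y) \<in> I}"
    define B where "B = {y \<in> T. (x', y) \<in> I}"
    have finAB: "finite A" "finite B"
      using fin by (auto simp: A_def B_def)
    have "\<forall>y\<in>A \<inter> B. \<forall>z\<in>A \<inter> B. y = z"
      using I S(2) unfolding rectangle_free_def A_def B_def by blast
    then have "card (A \<inter> B) \<le> Suc 0"
      using finAB card_le_Suc0_iff_eq[of "A \<inter> B"] by blast
    moreover have "card (A \<union> B) \<le> card T"
      using fin by (intro card_mono) (auto simp: A_def B_def)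
    moreover have "card A + card B = card (A \<union> B) + card (A \<inter> B)"
      using finAB by (rule card_Un_Int)
    moreover have "I \<inter> S \<times> T = Pair x ` A \<union> Pair x' ` B"
      by (auto simp: S A_def B_def)
    then have "card (I \<inter> S \<times> T) \<le> card A + card B"
      using card_Un_le[of "Pair x ` A" "Pair x' ` B"] by (simp add: card_image inj_on_def)
    ultimately show ?thesis
      using small 3 by linarith
  qed
qed

lemma rectangle_free_five:
  assumes I: "rectangle_free I" and fin: "finite S" "finite T"
    and small: "card S + card T \<le> 5"
  shows "card (I \<inter> S \<times> T) \<le> 4"
proof (cases "card S \<le> 2")
  case True
  then show ?thesis
    using rectangle_free_two_rows assms by blast
next
  case False
  then have "card (I\<inverse> \<inter> T \<times> S) \<le> 4"
    using rectangle_free_two_rows[OF rectangle_free_converse[OF I] fin(2,1)] small by simp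
  moreover have "I\<inverse> \<inter> T \<times> S = (I \<inter> S \<times> T)\<inverse>"
    by auto
  ultimately show ?thesis
    by simp
qed

text \<open>The first \<open>s\<close> vertices form the blue clique, the next \<open>N\<close> are
  the points, the following \<open>N\<close> the lines. The minimum is over the sizes of the blue
  and the red class of this colouring, which has no balanced copy.\<close>

lemma lbal_K5_lower:
  fixes n s N :: nat
  assumes n: "s + 2 * N \<le> n" and IN: "I \<subseteq> {..<N} \<times> {..<N}" and I: "rectangle_free I"
  shows "min ((s choose 2) + card I) ((n choose 2) - (s choose 2)) \<le> lbal n (complete_graph 5)"
proof -
  define \<phi> where "\<phi> = (\<lambda>(p, l). {s + p, s + N + l})"
  define H where "H = \<phi> ` I"
  define L where "L e = (if e \<subseteq> {..<s} then {Blue} else if e \<in> H then {Red, Blue} else {Red})" for e :: "nat set"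
  define R where "R = colour_class n L Red"
  define B where "B = colour_class n L Blue"
  have L: "two_list_colouring n L"
    by (simp add: two_list_colouring_def L_def)
  have finI: "finite I"
    using IN finite_subset by blast
  have "inj_on \<phi> ({..<N} \<times> {..<N})"
    by (auto simp: inj_on_def \<phi>_def doubleton_eq_iff)
  then have inj: "inj_on \<phi> I"
    using IN inj_on_subset by blast
  have H_sub: "H \<subseteq> pairs {s..<n}"
    using IN n by (fastforce simp: H_def \<phi>_def pairs_def)
  have H_out: "\<not> e \<subseteq> {..<s}" if "e \<in> H" for e
    using that by (auto simp: H_def \<phi>_def)
  have s_n: "pairs {..<s} \<subseteq> pairs {..<n}"
    using n by (intro pairs_mono) auto
  have R: "R = pairs {..<n} - pairs {..<s}"
    unfolding R_def colour_class_def edges_complete_graph L_def by (auto simp: pairs_def)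
  have "{s..<n} \<subseteq> {..<n}"
    by auto
  then have "H \<subseteq> pairs {..<n}"
    using H_sub pairs_mono by blast
  then have B: "B = pairs {..<s} \<union> H"
    unfolding B_def colour_class_def edges_complete_graph L_def
    using s_n by (auto simp: pairs_def split: if_splits)
  have cR: "card R = (n choose 2) - (s choose 2)"
    unfolding R using s_n by (subst card_Diff_subset) (auto simp: finite_pairs card_pairs)
  have "pairs {..<s} \<inter> H = {}"
    using H_out by (auto simp: pairs_def)
  then have cB: "card B = (s choose 2) + card I"
    unfolding B H_def using finI inj
    by (subst card_Un_disjoint) (auto simp: finite_pairs card_pairs card_image)
  \<comment> \<open>Let \<open>j\<close> of the five vertices lie in the clique. If
    \<open>j \<ge> 4\<close>, at least six edges are exclusively blue. Otherwise at most four edges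
    carry blue: \<open>j choose 2\<close> from the clique, plus at most 4 and at most
    \<open>(5 - j) choose 2\<close> from \<open>H\<close>.\<close>
  have unbalanced: "card (pairs W - B) \<ge> 6"
    if W: "W \<subseteq> {..<n}" "card W = 5" and blue: "card (pairs W - R) \<le> 5" for W
  proof -
    have finW: "finite W"
      using W finite_subset by blast
    define W1 where "W1 = W \<inter> {..<s}"
    define W2 where "W2 = W \<inter> {s..<n}"
    define j where "j = card W1"
    have fin12: "finite W1" "finite W2"
      using finW by (auto simp: W1_def W2_def)
    have "W = W1 \<union> W2" "W1 \<inter> W2 = {}"
      using W by (auto simp: W1_def W2_def)
    then have c2: "j + card W2 = 5"
      unfolding j_def using fin12 W by (metis card_Un_disjoint)
    have "pairs W - R = pairs W1"
      unfolding R W1_def using W by (auto simp: pairs_def)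
    then have j5: "j choose 2 \<le> 5"
      using blue fin12 by (simp add: card_pairs j_def)
    have "j \<le> 3"
    proof (rule ccontr)
      assume "\<not> j \<le> 3"
      then have "4 choose 2 \<le> j choose 2"
        by (intro binomial_right_mono) auto
      then show False
        using j5 by (simp add: choose_two)
    qed
    then have j: "j \<in> {0, 1, 2, 3}"
      by auto
    \<comment> \<open>The bound \<open>p < N\<close> keeps line vertices from being counted as
      points, so the shifted copies of \<open>S\<close> and \<open>T\<close> are disjoint.\<close>
    define S where "S = {p. s + p \<in> W2 \<and> p < N}"
    define T where "T = {l. s + N + l \<in> W2}"
    have "S = (\<lambda>p. s + p) -` (W2 \<inter> {..<s + N})" "T = (\<lambda>l. s + N + l) -` W2"
      by (auto simp: S_def T_def)
    then have finST: "finite S" "finite T"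
      using fin12 by (auto intro!: finite_vimageI simp: inj_on_def)
    have "card S + card T = card ((\<lambda>p. s + p) ` S) + card ((\<lambda>l. s + N + l) ` T)"
      by (simp add: card_image inj_on_def)
    also have "\<dots> = card ((\<lambda>p. s + p) ` S \<union> (\<lambda>l. s + N + l) ` T)"
      using finST by (subst card_Un_disjoint) (auto simp: S_def)
    also have "\<dots> \<le> card W2"
      using fin12 by (intro card_mono) (auto simp: S_def T_def)
    finally have ST: "card S + card T \<le> 5"
      using c2 by linarith
    have "H \<inter> pairs W \<subseteq> \<phi> ` (I \<inter> S \<times> T)"
    proof
      fix e assume e: "e \<in> H \<inter> pairs W"
      then obtain p l where pl: "e = {s + p, s + N + l}" "(p, l) \<in> I"
        by (auto simp: H_def \<phi>_def)
      then have "s + p \<in> W2" "s + N + l \<in> W2" "p < N"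
        using e W IN by (auto simp: pairs_def W2_def)
      then show "e \<in> \<phi> ` (I \<inter> S \<times> T)"
        using pl by (auto simp: S_def T_def \<phi>_def)
    qed
    then have "card (H \<inter> pairs W) \<le> card (\<phi> ` (I \<inter> S \<times> T))"
      using finI by (intro card_mono) auto
    also have "\<dots> \<le> card (I \<inter> S \<times> T)"
      using finI by (intro card_image_le) auto
    also have "\<dots> \<le> 4"
      using rectangle_free_five[OF I finST ST] .
    finally have h4: "card (H \<inter> pairs W) \<le> 4" .
    have "H \<inter> pairs W \<subseteq> pairs W2"
      using H_sub unfolding pairs_def W2_def by blast
    then have h2: "card (H \<inter> pairs W) \<le> card W2 choose 2"
      using fin12 by (metis card_mono card_pairs finite_pairs)
    have c2': "card W2 = 5 - j"
      using c2 by simp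
    have "(j choose 2) + card (H \<inter> pairs W) \<le> 4"
      using j h4 h2 unfolding c2' by (auto simp: choose_two)
    moreover have "pairs W \<inter> B = pairs W1 \<union> (H \<inter> pairs W)"
      unfolding B W1_def by (auto simp: pairs_def)
    then have "card (pairs W \<inter> B) \<le> (j choose 2) + card (H \<inter> pairs W)"
      using card_Un_le[of "pairs W1" "H \<inter> pairs W"] fin12 by (simp add: card_pairs j_def)
    moreover have "card (pairs W) = 10"
      using finW W by (simp add: card_pairs choose_two)
    then have "card (pairs W - B) + card (pairs W \<inter> B) = 10"
      using finW finite_pairs by (metis card_Int_Diff add.commute)
    ultimately show ?thesis
      by linarith
  qed
  have no: "\<not> (\<exists>H. is_copy n (complete_graph 5) H \<and> balanced R B H)"
  proof
    assume "\<exists>H. is_copy n (complete_graph 5) H \<and> balanced R B H"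
    then obtain W where "W \<subseteq> {..<n}" "card W = 5" "card (pairs W - R) \<le> 5" "card (pairs W - B) \<le> 5"
      unfolding R_def B_def balanced_K5_iff[OF L] by blast
    then show False
      using unbalanced[of W] by linarith
  qed
  show ?thesis
  proof (rule ccontr)
    assume "\<not> ?thesis"
    then have "lbal n (complete_graph 5) < card R" "lbal n (complete_graph 5) < card B"
      using cR cB by auto
    then show False
      using forces_balanced_copy_lbal[of n "complete_graph 5"] L no
      unfolding forces_balanced_copy_def R_def B_def by blast
  qed
qed

section \<open>Asymptotics\<close>

text \<open>With \<open>r = sqrt n\<close> this is the negation of \<open>edge_inequality\<close>.
  The quartic term is absorbed via \<open>12 * r^4 \<le> 18 * r * D\<close>; after cancelling
  \<open>D\<close>, the gain \<open>2 * \<epsilon> * r^2 > 20 * r\<close> beats the remaining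
  \<open>18 * r + 1\<close>.\<close>

lemma three_walk_contradiction:
  fixes r D \<epsilon> :: real
  assumes eps: "\<epsilon> > 0" and r: "r \<ge> 1" "r > 10 / \<epsilon>" and D: "D \<ge> (1 + \<epsilon>) * r ^ 3 / sqrt 2"
  shows "2 * D ^ 3 > r ^ 4 * ((r\<^sup>2 + 1) * D + 12 * r ^ 4)"
proof -
  have "r ^ 3 / sqrt 2 \<ge> r ^ 3 * (2 / 3)"
  proof -
    have "sqrt 2 \<le> 3 / 2"
      by (rule real_le_lsqrt) (auto simp: power2_eq_square)
    then show ?thesis
      using r by (simp add: field_simps)
  qed
  moreover have "D \<ge> r ^ 3 / sqrt 2"
  proof -
    have "r ^ 3 \<le> (1 + \<epsilon>) * r ^ 3"
      using eps r by (simp add: algebra_simps)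
    then show ?thesis
      using D by (smt (verit) divide_right_mono real_sqrt_ge_zero)
  qed
  ultimately have D1: "D \<ge> r ^ 3 * (2 / 3)" by linarith
  have r0: "r > 0" using r by simp
  then have Dpos: "D > 0"
    using D1 by (smt (verit) zero_less_power divide_pos_pos mult_pos_pos)
  have "r * (r ^ 3 * (2 / 3)) \<le> r * D"
    using D1 r0 by (intro mult_left_mono) auto
  then have "12 * r ^ 4 \<le> 18 * r * D"
    by (simp add: algebra_simps power_numeral_reduce)
  then have 1: "r ^ 4 * ((r\<^sup>2 + 1) * D + 12 * r ^ 4) \<le> r ^ 4 * ((r\<^sup>2 + 1) * D + 18 * r * D)"
    using r0 by (intro mult_left_mono) auto
  have "((1 + \<epsilon>) * r ^ 3 / sqrt 2)\<^sup>2 \<le> D\<^sup>2"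
    using D eps r0 by (intro power_mono) auto
  then have "(1 + \<epsilon>)\<^sup>2 * r ^ 6 \<le> 2 * D\<^sup>2"
    by (simp add: power_divide power_mult_distrib flip: power_mult)
  moreover have "(1 + 2 * \<epsilon>) * r ^ 6 \<le> (1 + \<epsilon>)\<^sup>2 * r ^ 6"
    using r0 by (intro mult_right_mono) (auto simp: power2_eq_square algebra_simps)
  moreover have "r ^ 4 * (r\<^sup>2 + 1 + 18 * r) < (1 + 2 * \<epsilon>) * r ^ 6"
  proof -
    have "10 < \<epsilon> * r"
      using r eps by (simp add: field_simps)
    then have "10 * r < \<epsilon> * r * r"
      using r0 by (intro mult_strict_right_mono)
    moreover have "(1 + 2 * \<epsilon>) * r\<^sup>2 = r\<^sup>2 + 2 * (\<epsilon> * r * r)"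
      by (simp add: algebra_simps power2_eq_square)
    ultimately have "r\<^sup>2 + 1 + 18 * r < (1 + 2 * \<epsilon>) * r\<^sup>2"
      using r by linarith
    then have "r ^ 4 * (r\<^sup>2 + 1 + 18 * r) < r ^ 4 * ((1 + 2 * \<epsilon>) * r\<^sup>2)"
      using r0 by (intro mult_strict_left_mono) auto
    then show ?thesis
      by (simp add: power_numeral_reduce mult_ac)
  qed
  ultimately have "r ^ 4 * (r\<^sup>2 + 1 + 18 * r) < 2 * D\<^sup>2"
    by linarith
  then have "r ^ 4 * (r\<^sup>2 + 1 + 18 * r) * D < 2 * D\<^sup>2 * D"
    using Dpos by (rule mult_strict_right_mono)
  then have "r ^ 4 * ((r\<^sup>2 + 1) * D + 18 * r * D) < 2 * D ^ 3"
    by (simp add: algebra_simps power_numeral_reduce)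
  with 1 show ?thesis
    by linarith
qed

lemma powr_three_halves: "real n powr (3 / 2) = sqrt (real n) ^ 3"
proof (cases "n = 0")
  case False
  have "sqrt (real n) ^ 3 = (real n powr (1 / 2)) powr (real 3)"
    using False by (subst powr_realpow) (auto simp: powr_half_sqrt)
  then show ?thesis
    by (simp add: powr_powr)
qed simp

text \<open>If both classes exceed \<open>b\<close>, inclusion-exclusion makes
  \<open>R \<inter> B\<close> too large for \<open>edge_inequality\<close>. Five doubly coloured
  edges on five vertices would leave at most five edges outside \<open>R\<close> and at most five
  outside \<open>B\<close>, hence a balanced copy.\<close>

lemma lbal_K5_upper:
  fixes \<epsilon> :: real
  assumes eps: "\<epsilon> > 0" and n: "5 \<le> n" "sqrt (real n) > 10 / \<epsilon>"
  shows "real (lbal n (complete_graph 5))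
       \<le> 1 / 2 * real (n choose 2) + (1 + \<epsilon>) * (1 / (4 * sqrt 2)) * real n powr (3 / 2)"
proof -
  define b where "b = 1 / 2 * real (n choose 2) + (1 + \<epsilon>) * (1 / (4 * sqrt 2)) * real n powr (3 / 2)"
  have b: "b \<ge> 0"
    using eps by (simp add: b_def)
  have "forces_balanced_copy n (complete_graph 5) (nat \<lfloor>b\<rfloor>)"
    unfolding forces_balanced_copy_def
  proof (intro allI impI, elim conjE)
    fix L
    define R where "R = colour_class n L Red"
    define B where "B = colour_class n L Blue"
    assume L: "two_list_colouring n L"
      and "nat \<lfloor>b\<rfloor> < card (colour_class n L Red)" "nat \<lfloor>b\<rfloor> < card (colour_class n L Blue)"
    then have RB: "b < real (card R)" "b < real (card B)"
      using b unfolding R_def B_def by linarith+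
    have un: "R \<union> B = pairs {..<n}"
      unfolding R_def B_def by (rule colour_classes_cover[OF L])
    then have fin: "finite R" "finite B"
      by (metis finite_Un finite_lessThan finite_pairs)+
    have "card R + card B = (n choose 2) + card (R \<inter> B)"
      using card_Un_Int[OF fin] un by (simp add: card_pairs)
    then have eq: "real (card R) + real (card B) = real (n choose 2) + real (card (R \<inter> B))"
      by (metis of_nat_add)
    have big: "2 * real (card (R \<inter> B)) \<ge> (1 + \<epsilon>) * sqrt (real n) ^ 3 / sqrt 2"
    proof -
      define z where "z = (1 + \<epsilon>) * (1 / (4 * sqrt 2)) * sqrt (real n) ^ 3"
      have "(1 + \<epsilon>) * sqrt (real n) ^ 3 / sqrt 2 = 4 * z"
        by (simp add: z_def)
      moreover have "b = 1 / 2 * real (n choose 2) + z"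
        by (simp add: b_def z_def powr_three_halves)
      ultimately show ?thesis
        using RB eq by linarith
    qed
    show "\<exists>H. is_copy n (complete_graph 5) H \<and> balanced (colour_class n L Red) (colour_class n L Blue) H"
      unfolding balanced_K5_iff[OF L]
    proof (rule ccontr)
      assume none: "\<not> (\<exists>W \<subseteq> {..<n}. card W = 5 \<and> card (pairs W - colour_class n L Red) \<le> 5
          \<and> card (pairs W - colour_class n L Blue) \<le> 5)"
      interpret sparse_graph "{..<n}" "R \<inter> B"
      proof
        fix W :: "nat set" assume W: "W \<subseteq> {..<n}" "card W = 5"
        have finW: "finite (pairs W)"
          using W finite_subset finite_pairs by blast
        have "card (pairs W) = 10"
          using W finite_subset by (subst card_pairs) (auto simp: choose_two)
        then have "card (pairs W - R \<inter> B) + card (pairs W \<inter> (R \<inter> B)) = 10"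
          using finW by (metis card_Int_Diff add.commute)
        moreover have "card (pairs W - R) \<le> card (pairs W - R \<inter> B)"
          "card (pairs W - B) \<le> card (pairs W - R \<inter> B)"
          using finW by (auto intro!: card_mono)
        moreover have "\<not> (card (pairs W - R) \<le> 5 \<and> card (pairs W - B) \<le> 5)"
          using none W unfolding R_def[symmetric] B_def[symmetric] by blast
        ultimately show "card (pairs W \<inter> (R \<inter> B)) \<le> 4"
          by linarith
      qed (use un n in auto)
      have sq: "sqrt (real n) ^ 4 = (real n)\<^sup>2" "(sqrt (real n))\<^sup>2 = real n"
        using power_mult[of "sqrt (real n)" 2 2] by simp_all
      have "sqrt (real n) \<ge> 1"
        using n by simp
      from three_walk_contradiction[OF eps this n(2) big] edge_inequality show False
        unfolding sq by simp
    qed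
  qed
  then have "lbal n (complete_graph 5) \<le> nat \<lfloor>b\<rfloor>"
    unfolding lbal_def by (rule Least_le)
  then show ?thesis
    using b unfolding b_def[symmetric] by linarith
qed

section \<open>Choice of the parameters for the lower bound\<close>

lemma real_choose_two: "real (m choose 2) = real m * (real m - 1) / 2"
proof (cases m)
  case (Suc k)
  have "2 * (m choose 2) = m * (m - 1)"
    by (simp add: choose_two Suc)
  then have "2 * real (m choose 2) = real m * real (m - 1)"
    by (metis of_nat_mult of_nat_numeral)
  then show ?thesis
    by (simp add: Suc)
qed simp

lemma power_two_between:
  fixes x :: real
  assumes "x \<ge> 2"
  obtains k :: nat where "k > 0" "2 ^ k \<le> x" "x < 2 * 2 ^ k"
proof -
  define k where "k = nat \<lfloor>log 2 x\<rfloor>"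
  have l: "log 2 x \<ge> 1"
    using assms by simp
  then have k: "real k \<le> log 2 x" "log 2 x < real k + 1" "k > 0"
    unfolding k_def by linarith+
  then have "2 powr real k \<le> x" "x < 2 powr (real k + 1)"
    using assms by (simp_all add: le_log_iff log_less_iff)
  then show thesis
    using k that[of k] by (simp add: powr_add powr_realpow)
qed

lemma rectangle_free_many:
  fixes y :: real
  assumes y: "y \<ge> 2"
  obtains N I where "real N \<le> y\<^sup>2" "I \<subseteq> {..<N} \<times> {..<N}" "rectangle_free I"
    "real (card I) \<ge> 74 / 125 * y ^ 3 - 2 * y\<^sup>2"
proof -
  \<comment> \<open>So \<open>2^k\<close> lies between \<open>21 / 25 * y\<close> and
    \<open>42 / 25 * y\<close>. The factor 42/25 is close to the fourth root of 8, which balances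
    the two extremes: the cube of half the factor, relevant if \<open>a = 2^k\<close>, and its
    reciprocal, relevant otherwise.\<close>
  obtain k where k: "k > 0" "2 ^ k \<le> 42 / 25 * y" "42 / 25 * y < 2 * 2 ^ k"
    using power_two_between[of "42 / 25 * y"] y by auto
  define q :: real where "q = 2 ^ k"
  have q: "q > 0" "q \<le> 42 / 25 * y" "21 / 25 * y < q"
    using k by (auto simp: q_def)
  define a where "a = min (2 ^ k) (nat \<lfloor>y\<^sup>2 / q\<rfloor>)"
  obtain I where I: "I \<subseteq> {..<a * 2 ^ k} \<times> {..<a * 2 ^ k}" "card I = a\<^sup>2 * 2 ^ k" "rectangle_free I"
    using rectangle_free_incidence[of a k] k(1) unfolding a_def by auto
  have "a \<le> nat \<lfloor>y\<^sup>2 / q\<rfloor>" "0 \<le> y\<^sup>2 / q"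
    using q by (simp_all add: a_def)
  then have "real a \<le> y\<^sup>2 / q"
    by linarith
  then have "real (a * 2 ^ k) \<le> y\<^sup>2"
    using q by (simp add: q_def field_simps)
  moreover have "real (card I) \<ge> 74 / 125 * y ^ 3 - 2 * y\<^sup>2"
  proof (cases "a = 2 ^ k")
    case True
    then have "real (card I) = q ^ 3"
      by (simp add: I(2) q_def power_numeral_reduce)
    moreover have "(21 / 25 * y) ^ 3 \<le> q ^ 3"
      using q y by (intro power_mono) auto
    moreover have "(21 / 25 * y) ^ 3 \<ge> 74 / 125 * y ^ 3"
      using y by (simp add: power_mult_distrib power_divide)
    ultimately show ?thesis
      by (smt (verit) zero_le_power2)
  next
    case False
    then have "a = nat \<lfloor>y\<^sup>2 / q\<rfloor>"
      by (simp add: a_def min_def split: if_splits)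
    then have a: "real a > y\<^sup>2 / q - 1"
      by linarith
    have "(real a)\<^sup>2 \<ge> (y\<^sup>2 / q)\<^sup>2 - 2 * (y\<^sup>2 / q)"
    proof (cases "y\<^sup>2 / q \<ge> 1")
      case True
      then have "(y\<^sup>2 / q - 1)\<^sup>2 \<le> (real a)\<^sup>2"
        using a by (intro power_mono) auto
      then show ?thesis
        by (simp add: power2_eq_square algebra_simps)
    next
      case False
      then have "(y\<^sup>2 / q) * (y\<^sup>2 / q) \<le> 1 * (y\<^sup>2 / q)"
        using q by (intro mult_right_mono) auto
      then show ?thesis
        using q unfolding power2_eq_square[of "y\<^sup>2 / q"] by (smt (verit) divide_nonneg_pos zero_le_power2)
    qed
    then have "q * ((y\<^sup>2 / q)\<^sup>2 - 2 * (y\<^sup>2 / q)) \<le> q * (real a)\<^sup>2"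
      using q by (intro mult_left_mono) auto
    also have "\<dots> = real (card I)"
      by (simp add: I(2) q_def)
    also have "q * ((y\<^sup>2 / q)\<^sup>2 - 2 * (y\<^sup>2 / q)) = y ^ 4 / q - 2 * y\<^sup>2"
      using q by (simp add: field_simps power2_eq_square power_numeral_reduce)
    finally have "y ^ 4 / q - 2 * y\<^sup>2 \<le> real (card I)" .
    moreover have "74 / 125 * y ^ 3 \<le> y ^ 4 / q"
    proof -
      have "74 / 125 * y ^ 3 * q \<le> 74 / 125 * y ^ 3 * (42 / 25 * y)"
        using q y by (intro mult_left_mono) auto
      also have "\<dots> \<le> y ^ 4"
        using y by (simp add: power_numeral_reduce)
      finally show ?thesis
        using q by (simp add: field_simps)
    qed
    ultimately show ?thesis
      by linarith
  qed
  ultimately show thesis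
    using that I by blast
qed

text \<open>The parameter \<open>a\<close> satisfies \<open>2 * a + 1 / sqrt 2 = 1\<close>: a clique
  on about \<open>n / sqrt 2\<close> vertices leaves room for two sides of
  \<open>a * n = y^2\<close> vertices each.\<close>

lemma lbal_K5_lower_bound:
  fixes a y :: real
  assumes a: "a = (sqrt 2 - 1) / (2 * sqrt 2)" and y: "y = sqrt (a * real n)" and large: "y \<ge> 2000"
  shows "1 / 2 * real (n choose 2) + 2 * a * y ^ 3 \<le> real (lbal n (complete_graph 5))"
proof -
  \<comment> \<open>A clique with at most \<open>M\<close> edges leaves the red class the desired
    size, which equals \<open>M + 4 * a * y^3\<close>; the bipartite graph must then supply about
    \<open>4 * a * y^3\<close> blue edges.\<close>
  define M where "M = real (n choose 2) / 2 - 2 * a * y ^ 3"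
  have sqrt2: "707 / 500 \<le> sqrt 2"
    by (rule real_le_rsqrt) (simp add: power2_eq_square)
  have a2: "2 * a = 1 - 1 / sqrt 2"
    by (simp add: a field_simps)
  have a': "4 * a = 2 - sqrt 2"
    using a2 real_div_sqrt[of 2] by simp
  have "sqrt 2 \<le> 71 / 50"
    by (rule real_le_lsqrt) (auto simp: power2_eq_square)
  then have a_bounds: "a > 18 / 125" "4 * a \<le> 293 / 500"
    using a' sqrt2 by auto
  have yn: "y\<^sup>2 = a * real n"
    using a_bounds by (simp add: y)
  \<comment> \<open>The constant 2000 gives
    \<open>(74 / 125 - 293 / 500) * y^3 \<ge> 12 * y^2\<close>, which covers the loss of
    \<open>2 * y^2\<close> in the incidences and of at most \<open>n \<le> 7 * y^2\<close> from
    rounding the clique size.\<close>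
  have y3: "y ^ 3 \<ge> 2000 * y\<^sup>2"
    using large by (simp add: power_numeral_reduce mult_right_mono)
  have n7: "real n \<le> 7 * y\<^sup>2"
    unfolding yn using a_bounds by (simp add: mult_le_cancel_right1 flip: mult.assoc)
  have slack: "4 * a * y ^ 3 > real n"
  proof -
    have "72 / 125 * y ^ 3 \<le> 4 * a * y ^ 3"
      using a_bounds large by (intro mult_right_mono) auto
    moreover have "y\<^sup>2 > 0"
      using large by simp
    ultimately show ?thesis
      using y3 n7 by linarith
  qed
  have n_large: "real n \<ge> 2000"
  proof -
    have "2000 * 1 \<le> y * y"
      using large by (intro mult_mono) auto
    also have "\<dots> \<le> 1 * real n"
      unfolding power2_eq_square[symmetric] yn using a_bounds by (intro mult_right_mono) auto
    finally show ?thesis by simp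
  qed
  have M: "M \<ge> 0"
  proof -
    have "2 * a * y ^ 3 \<le> 1 * y ^ 3"
      using a_bounds large by (intro mult_right_mono) auto
    moreover have "2000 * y ^ 3 \<le> y * y ^ 3"
      using large by (intro mult_right_mono) auto
    moreover have "y * y ^ 3 = (y\<^sup>2)\<^sup>2"
      by (simp add: power_numeral_reduce)
    moreover have "(y\<^sup>2)\<^sup>2 \<le> (1 * real n)\<^sup>2"
      unfolding yn using a_bounds by (intro power_mono mult_right_mono) auto
    moreover have "2000 * real n \<le> real n * real n"
      using n_large by (intro mult_right_mono) auto
    ultimately show ?thesis
      unfolding M_def real_choose_two by (simp add: algebra_simps power2_eq_square)
  qed
  \<comment> \<open>Thus \<open>s\<close> is the largest clique size with at most \<open>M\<close>
    edges. Since \<open>M\<close> is nonnegative, \<open>t\<close> is positive and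
    \<open>t - 1\<close> is not truncated.\<close>
  define t where "t = (LEAST t. M < real (t choose 2))"
  define s where "s = t - 1"
  have "M < real ((n + 1) choose 2)"
  proof -
    have "M \<le> real (n choose 2)"
    proof -
      have "0 \<le> 2 * a * y ^ 3"
        using a_bounds large by simp
      then show ?thesis
        unfolding M_def by simp
    qed
    also have "\<dots> < real ((n + 1) choose 2)"
      using n_large by (simp add: real_choose_two algebra_simps)
    finally show ?thesis .
  qed
  then have t: "M < real (t choose 2)" "t \<le> n + 1"
    unfolding t_def by (rule LeastI, rule Least_le)
  have "t \<noteq> 0"
    using t(1) M by (cases t) (auto simp: numeral_2_eq_2)
  then have ts: "t = s + 1" "s < t"
    by (simp_all add: s_def)
  then have sM: "real (s choose 2) \<le> M"
    using not_less_Least[of s "\<lambda>t. M < real (t choose 2)"] unfolding t_def by simp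
  have sn: "s \<le> n"
    using t ts by simp
  have Ms: "M < real (s choose 2) + real s"
    using t(1) unfolding ts(1) real_choose_two by (simp add: algebra_simps add_divide_distrib diff_divide_distrib)
  \<comment> \<open>Otherwise \<open>n^2 \<le> 2 * s^2\<close>, and the bound on
    \<open>s choose 2\<close> would force \<open>8 * a * y^3 \<le> 2 * s - n \<le> n\<close>,
    against \<open>slack\<close>.\<close>
  have s_sqrt: "real s \<le> real n / sqrt 2"
  proof (rule ccontr)
    assume "\<not> ?thesis"
    then have "(real n / sqrt 2)\<^sup>2 \<le> (real s)\<^sup>2"
      by (intro power_mono) auto
    then have "real n * real n \<le> 2 * (real s * real s)"
      by (simp add: power_divide power2_eq_square)
    moreover have "real s \<le> real n"
      using sn by simp
    moreover have "2 * (real s * real s) - 2 * real s \<le> real n * real n - real n - 8 * (a * y ^ 3)"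
    proof -
      have dbl: "2 * real (m choose 2) = real m * real m - real m" for m
        by (simp add: real_choose_two algebra_simps)
      have "2 * (2 * real (s choose 2)) \<le> 2 * real (n choose 2) - 8 * (a * y ^ 3)"
        using sM unfolding M_def by simp
      then show ?thesis
        unfolding dbl right_diff_distrib .
    qed
    ultimately show False
      using slack n_large unfolding mult.assoc by linarith
  qed
  obtain N I where NI: "real N \<le> y\<^sup>2" "I \<subseteq> {..<N} \<times> {..<N}" "rectangle_free I"
    "real (card I) \<ge> 74 / 125 * y ^ 3 - 2 * y\<^sup>2"
    using rectangle_free_many[of y] large by auto
  have "real s + 2 * real N \<le> real n"
  proof -
    have "2 * real N \<le> (2 * a) * real n"
      using NI(1) yn by simp
    then show ?thesis
      using s_sqrt unfolding a2 by (simp add: algebra_simps)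
  qed
  then have "s + 2 * N \<le> n"
    by linarith
  from lbal_K5_lower[OF this NI(2,3)]
  have "min ((s choose 2) + card I) ((n choose 2) - (s choose 2)) \<le> lbal n (complete_graph 5)" .
  moreover have "M + 4 * a * y ^ 3 \<le> real ((s choose 2) + card I)"
  proof -
    have "4 * a * y ^ 3 \<le> 293 / 500 * y ^ 3"
      using a_bounds large by (intro mult_right_mono) auto
    then show ?thesis
      using Ms NI(4) y3 n7 sn by simp
  qed
  moreover have "M + 4 * a * y ^ 3 \<le> real ((n choose 2) - (s choose 2))"
  proof -
    have "s choose 2 \<le> n choose 2"
      using sn by (rule binomial_right_mono)
    then show ?thesis
      using sM unfolding M_def by (simp add: of_nat_diff)
  qed
  ultimately have "M + 4 * a * y ^ 3 \<le> real (lbal n (complete_graph 5))"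
    by (smt (verit) min_def of_nat_mono)
  then show ?thesis
    unfolding M_def by simp
qed

theorem theorem14:
  fixes c \<epsilon> :: real
  assumes c: "c = 2 * ((sqrt 2 - 1) / (2 * sqrt 2)) powr (5 / 2)"
    and eps: "\<epsilon> > 0"
  shows "\<exists>N. \<forall>n\<ge>N.
     1 / 2 * real (n choose 2) + (1 - \<epsilon>) * c * real n powr (3 / 2)
       \<le> real (lbal n (complete_graph 5)) \<and>
     real (lbal n (complete_graph 5))
       \<le> 1 / 2 * real (n choose 2) + (1 + \<epsilon>) * (1 / (4 * sqrt 2)) * real n powr (3 / 2)"
proof -
  define a :: real where "a = (sqrt 2 - 1) / (2 * sqrt 2)"
  have a: "a > 0"
    by (simp add: a_def)
  \<comment> \<open>The three terms provide five vertices, the strict bound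
    \<open>sqrt n > 10 / \<epsilon>\<close>, and \<open>y \<ge> 2000\<close>.\<close>
  define N where "N = nat \<lceil>max 5 (max ((10 / \<epsilon>)\<^sup>2 + 1) (2000\<^sup>2 / a))\<rceil>"
  have "1 / 2 * real (n choose 2) + (1 - \<epsilon>) * c * real n powr (3 / 2)
       \<le> real (lbal n (complete_graph 5)) \<and>
     real (lbal n (complete_graph 5))
       \<le> 1 / 2 * real (n choose 2) + (1 + \<epsilon>) * (1 / (4 * sqrt 2)) * real n powr (3 / 2)"
    if "n \<ge> N" for n
  proof
    have "max 5 (max ((10 / \<epsilon>)\<^sup>2 + 1) (2000\<^sup>2 / a)) \<le> real n"
      using that unfolding N_def by linarith
    then have n: "5 \<le> real n" "(10 / \<epsilon>)\<^sup>2 < real n" "2000\<^sup>2 / a \<le> real n"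
      by simp_all
    have "10 / \<epsilon> < sqrt (real n)"
      using n(2) by (rule real_less_rsqrt)
    then show "real (lbal n (complete_graph 5))
       \<le> 1 / 2 * real (n choose 2) + (1 + \<epsilon>) * (1 / (4 * sqrt 2)) * real n powr (3 / 2)"
      using lbal_K5_upper[OF eps] n(1) by simp
    define y where "y = sqrt (a * real n)"
    have "2000\<^sup>2 \<le> a * real n"
      using n(3) a by (simp add: field_simps)
    then have "2000 \<le> y"
      unfolding y_def by (rule real_le_rsqrt)
    then have lower: "1 / 2 * real (n choose 2) + 2 * a * y ^ 3 \<le> real (lbal n (complete_graph 5))"
      using lbal_K5_lower_bound[OF a_def y_def] by simp
    \<comment> \<open>One factor \<open>a\<close> splits off the exponent 5/2; the rest combines
      with \<open>n powr (3 / 2)\<close> to \<open>y^3\<close>, so \<open>c * n powr (3 / 2)\<close>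
      is the excess \<open>2 * a * y^3\<close>.\<close>
    have "a powr (5 / 2) = a * a powr (3 / 2)"
      using a powr_add[of a 1 "3 / 2"] by simp
    moreover have "a powr (3 / 2) * real n powr (3 / 2) = y ^ 3"
    proof -
      have "y ^ 3 = ((a * real n) powr (1 / 2)) powr (real 3)"
        using \<open>2000 \<le> y\<close> a n(1) by (subst powr_realpow) (auto simp: powr_half_sqrt y_def)
      also have "\<dots> = (a * real n) powr (3 / 2)"
        by (simp add: powr_powr)
      finally show ?thesis
        using a by (simp add: powr_mult)
    qed
    ultimately have "c * real n powr (3 / 2) = 2 * a * y ^ 3"
      unfolding c a_def[symmetric] by (simp add: mult.assoc)
    moreover have "(1 - \<epsilon>) * (c * real n powr (3 / 2)) \<le> 1 * (c * real n powr (3 / 2))"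
      unfolding c using eps by (intro mult_right_mono) auto
    ultimately show "1 / 2 * real (n choose 2) + (1 - \<epsilon>) * c * real n powr (3 / 2)
       \<le> real (lbal n (complete_graph 5))"
      using lower by (simp add: mult.assoc)
  qed
  then show ?thesis
    by blast
qed

end
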